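(* Let $n\ge 1$ and $k\ge 0$ be integers. The number of perfect matchings on $\{1,2,\dots,2n\}$ with no even-to-odd matches and exactly $k$ even-to-even matches is $\big((2k-1)!!\big)^{2}\,S(n+1,2k+1)$.
   Context: A perfect matching on $\{1,\dots,2n\}$ is a partition of this set into 2-element subsets, called matches. An even-to-odd match is a match consisting of an even number and a larger odd number. An even-to-even match is a match consisting of two even numbers. $S(n,k)$ is the Stirling partition number (second kind): the number of partitions of $\{1,\dots,n\}$ into $k$ nonempty blocks. $(2k-1)!!=1\cdot3\cdots(2k-1)$, with $(-1)!!=1$. *)

theory Defs
  imports Main "HOL-Library.Disjoint_Sets" "HOL-Combinatorics.Stirling"
begin

definition perfect_matching_on :: "'a set \<Rightarrow> 'a set set \<Rightarrow> bool" where
  "perfect_matching_on A M \<longleftrightarrow> partition_on A M \<and> (\<forall>m\<in>M. card m = 2)"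

definition even_to_odd :: "nat set \<Rightarrow> bool" where
  "even_to_odd m \<longleftrightarrow> (\<exists>a b. m = {a, b} \<and> even a \<and> odd b \<and> a < b)"

definition even_to_even :: "nat set \<Rightarrow> bool" where
  "even_to_even m \<longleftrightarrow> (\<exists>a b. m = {a, b} \<and> even a \<and> even b \<and> a \<noteq> b)"

text \<open>\<open>odd_double_fact k\<close> is $(2k-1)!!$; the argument is \<open>k\<close> itself, so that $(-1)!! = 1$ is the
  value at \<open>0\<close>, the empty product.\<close>

definition odd_double_fact :: "nat \<Rightarrow> nat" where
  "odd_double_fact k = (\<Prod>i=1..k. 2 * i - 1)"

text \<open>The library introduces \<open>Stirling\<close> by its recurrence. The lemma \<open>card_partitions_eq_Stirling\<close>
  shows that it counts set partitions by number of blocks.\<close>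

lemma finite_partitions_of_card:
  assumes "finite A"
  shows "finite {P. partition_on A P \<and> card P = k}"
  by (rule finite_subset[of _ "Pow (Pow A)"]) (use assms in \<open>auto simp: partition_on_def\<close>)

lemma partitions_insert_eq:
  assumes A: "finite A" and x: "x \<notin> A"
  shows "{P. partition_on (insert x A) P \<and> card P = Suc k} =
    insert {x} ` {P. partition_on A P \<and> card P = k} \<union>
    (\<lambda>(Q, b). insert (insert x b) (Q - {b})) ` (SIGMA Q:{P. partition_on A P \<and> card P = Suc k}. Q)"
    (is "?L = ?R1 \<union> ?R2")
proof (intro equalityI subsetI)
  fix P assume "P \<in> ?L"
  then have P: "partition_on (insert x A) P" and c: "card P = Suc k" by auto
  have finP: "finite P" using c card.infinite by fastforce
  obtain B where B: "B \<in> P" "x \<in> B" using P by (auto simp: partition_on_def)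
  have dj: "C \<inter> D = {}" if "C \<in> P" "D \<in> P" "C \<noteq> D" for C D
    using P that by (auto simp: partition_on_def disjoint_def)
  have others: "x \<notin> C" if "C \<in> P - {B}" for C using dj[of C B] that B by auto
  have union: "\<Union>(P - {B}) = insert x A - B"
  proof -
    have "\<Union>P = insert x A" using P by (simp add: partition_on_def)
    then show ?thesis using dj B by blast
  qed
  have djP: "disjoint (P - {B})" "{} \<notin> P - {B}" using P by (auto simp: partition_on_def disjoint_def)
  show "P \<in> ?R1 \<union> ?R2"
  proof (cases "B = {x}")
    case True
    have "partition_on A (P - {B})"
      using union djP x True by (simp add: partition_on_def)
    moreover have "card (P - {B}) = k" using c B finP by simp
    moreover have "P = insert {x} (P - {B})" using B True by auto
    ultimately show ?thesis by blast
  next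
    case False
    define b where "b = B - {x}"
    have b: "b \<noteq> {}" "x \<notin> b" "B = insert x b" using B False by (auto simp: b_def)
    have bn: "b \<notin> P" using dj[of b B] B b by auto
    let ?Q = "insert b (P - {B})"
    have BA: "B \<subseteq> insert x A" using P B by (auto simp: partition_on_def)
    have "partition_on A ?Q"
      unfolding partition_on_def
    proof (intro conjI)
      show "\<Union>?Q = A" using union x b BA by auto
      show "disjoint ?Q" using dj B b by (auto simp: disjoint_def)
      show "{} \<notin> ?Q" using b djP by auto
    qed
    moreover have "card ?Q = Suc k" using c B finP bn by simp
    moreover have "P = insert (insert x b) (?Q - {b})" using B b bn by auto
    ultimately have "P \<in> ?R2"
      by (intro image_eqI[of _ _ "(?Q, b)"]) auto
    then show ?thesis by blast
  qed
next
  fix P assume "P \<in> ?R1 \<union> ?R2"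
  then show "P \<in> ?L"
  proof
    assume "P \<in> ?R1"
    then obtain Q where Q: "partition_on A Q" "card Q = k" "P = insert {x} Q" by auto
    have xQ: "\<forall>C\<in>Q. x \<notin> C" using Q x by (auto simp: partition_on_def)
    have "finite Q" using finite_elements A Q by blast
    moreover have "{x} \<notin> Q" using xQ by blast
    ultimately have "card P = Suc k" using Q by simp
    moreover have "partition_on (insert x A) P"
      using Q xQ by (auto simp: partition_on_def disjoint_def)
    ultimately show ?thesis by simp
  next
    assume "P \<in> ?R2"
    then obtain Q b where Q: "partition_on A Q" "card Q = Suc k" "b \<in> Q"
      "P = insert (insert x b) (Q - {b})" by auto
    have xQ: "\<forall>C\<in>Q. x \<notin> C" using Q x by (auto simp: partition_on_def)
    have "finite Q" using finite_elements A Q by blast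
    moreover have "insert x b \<notin> Q - {b}" using xQ by auto
    ultimately have "card P = Suc k" using Q by simp
    moreover have "partition_on (insert x A) P"
      unfolding partition_on_def
    proof (intro conjI)
      show "\<Union>P = insert x A" using Q by (auto simp: partition_on_def)
      have dj: "C \<inter> D = {}" if "C \<in> Q" "D \<in> Q" "C \<noteq> D" for C D
        using Q that by (auto simp: partition_on_def disjoint_def)
      show "disjoint P" unfolding disjoint_def
      proof (intro ballI impI)
        fix C D assume "C \<in> P" "D \<in> P" "C \<noteq> D"
        then consider "C = insert x b" "D \<in> Q - {b}" | "D = insert x b" "C \<in> Q - {b}"
          | "C \<in> Q" "D \<in> Q" using Q by auto
        then show "C \<inter> D = {}"
        proof cases
          case 1 then show ?thesis using dj[of b D] xQ Q by auto
        next
          case 2 then show ?thesis using dj[of b C] xQ Q by auto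
        next
          case 3 then show ?thesis using dj[of C D] \<open>C \<noteq> D\<close> by simp
        qed
      qed
      show "{} \<notin> P" using Q by (auto simp: partition_on_def)
    qed
    ultimately show ?thesis by simp
  qed
qed

lemma inj_on_insert_into_block:
  assumes x: "x \<notin> A"
  shows "inj_on (\<lambda>(Q, b). insert (insert x b) (Q - {b})) (SIGMA Q:{P. partition_on A P \<and> card P = m}. Q)"
proof (rule inj_onI, clarify)
  fix Q b R d
  assume Q: "partition_on A Q" "b \<in> Q" and R: "partition_on A R" "d \<in> R"
    and eq: "insert (insert x b) (Q - {b}) = insert (insert x d) (R - {d})"
  have xQ: "x \<notin> C" if "C \<in> Q" for C using Q that x by (auto simp: partition_on_def)
  have xR: "x \<notin> C" if "C \<in> R" for C using R that x by (auto simp: partition_on_def)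
  have "insert x b \<notin> R - {d}" using xR by auto
  then have "insert x b = insert x d" using eq by blast
  then have bd: "b = d" using xQ[OF Q(2)] xR[OF R(2)] by auto
  have "insert x b \<notin> Q" "insert x b \<notin> R" using xQ xR by auto
  then have "Q - {b} = R - {b}" using eq bd by (metis Diff_iff insert_ident)
  then show "Q = R \<and> b = d" using bd Q R by auto
qed

lemma card_partitions_eq_Stirling:
  assumes "finite A"
  shows "card {P. partition_on A P \<and> card P = k} = Stirling (card A) k"
  using assms
proof (induction A arbitrary: k rule: finite_induct)
  case empty
  have eq: "{P. partition_on {} P \<and> card P = k} = (if k = 0 then {{}} else {} :: 'a set set set)"
    by (auto simp: partition_on_empty)
  show ?case unfolding eq by (cases k) simp_all
next
  case (insert x A)
  show ?case
  proof (cases k)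
    case 0
    have "P = {}" if "partition_on (insert x A) P" "card P = 0" for P
      using that finite_elements[of "insert x A" P] insert.hyps by simp
    then have eq: "{P. partition_on (insert x A) P \<and> card P = 0} = {}"
      by (auto simp: partition_on_def)
    show ?thesis unfolding 0 eq using insert.hyps by simp
  next
    case (Suc j)
    let ?F = "\<lambda>k. {P. partition_on A P \<and> card P = k}"
    let ?f = "\<lambda>(Q, b). insert (insert x b) (Q - {b})"
    have fin: "finite (?F i)" for i by (rule finite_partitions_of_card[OF insert.hyps(1)])
    have finQ: "finite Q" if "Q \<in> ?F i" for Q i
      using that finite_elements[OF insert.hyps(1), of Q] by simp
    have notin: "x \<notin> C" if "C \<in> Q" "Q \<in> ?F i" for C Q i
      using that insert.hyps by (auto simp: partition_on_def)
    have inj: "inj_on (insert {x}) (?F j)"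
    proof (rule inj_onI)
      fix Q R assume "Q \<in> ?F j" "R \<in> ?F j" "insert {x} Q = insert {x} R"
      moreover from this have "{x} \<notin> Q" "{x} \<notin> R" using notin by blast+
      ultimately show "Q = R" by (metis insert_ident)
    qed
    have dj: "insert {x} ` ?F j \<inter> ?f ` (SIGMA Q:?F (Suc j). Q) = {}"
    proof -
      have "{x} \<notin> ?f (Q, b)" if "Q \<in> ?F (Suc j)" "b \<in> Q" for Q b
      proof -
        have "b \<noteq> {}" using that by (auto simp: partition_on_def)
        moreover have "x \<notin> b" "{x} \<notin> Q" using that notin by blast+
        ultimately show ?thesis by auto
      qed
      then show ?thesis by fastforce
    qed
    have finS: "finite (SIGMA Q:?F (Suc j). Q)"
      by (rule finite_SigmaI[OF fin finQ])
    have "card (insert {x} ` ?F j \<union> ?f ` (SIGMA Q:?F (Suc j). Q))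
        = card (?F j) + card (SIGMA Q:?F (Suc j). Q)"
      by (simp only: card_Un_disjoint[OF finite_imageI[OF fin] finite_imageI[OF finS] dj]
          card_image[OF inj] card_image[OF inj_on_insert_into_block[OF insert.hyps(2)]])
    also have "card (SIGMA Q:?F (Suc j). Q) = Suc j * card (?F (Suc j))"
    proof -
      have "card (SIGMA Q:?F (Suc j). Q) = (\<Sum>Q\<in>?F (Suc j). card Q)"
        by (rule card_SigmaI[OF fin]) (use finQ in blast)
      also have "\<dots> = (\<Sum>Q\<in>?F (Suc j). Suc j)" by (rule sum.cong) auto
      finally show ?thesis by simp
    qed
    finally show ?thesis
      unfolding Suc partitions_insert_eq[OF insert.hyps, of j] insert.IH card_insert_disjoint[OF insert.hyps]
      by simp
  qed
qed

end

theory Submission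
  imports Defs
begin

text \<open>
  Without even-to-odd matches, a perfect matching \<open>M\<close> of \<open>{1..2 * n}\<close> splits into a set \<open>P\<close> of
  odd-to-even matches, a perfect matching of the even numbers that \<open>P\<close> leaves uncovered, and a
  perfect matching of the odd numbers that \<open>P\<close> leaves uncovered. Conversely, any three such pieces
  fit together (\<open>perfect_matching_parity_decomposition\<close>). Every match of \<open>P\<close> covers one number of
  each parity, so the two uncovered sets have equal size, and this size is \<open>2 * k\<close> exactly when
  there are \<open>k\<close> even-to-even matches. A set of size \<open>2 * k\<close> has $(2k-1)!!$ perfect matchings
  (\<open>card_perfect_matchings\<close>), whichever set it is, and so \<open>P\<close> contributes $((2k-1)!!)^2$.

  It remains to count the sets \<open>P\<close>. Writing a match as $\{2i-1, 2j\}$ with $i \le j$, they are the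
  placements of $n-2k$ non-attacking rooks on the staircase board $1 \le i \le j \le n$, and
  placements leaving \<open>u\<close> columns empty are well known to be counted by $S(n+1,u+1)$. Here
  \<open>card_odd_to_even_matchings\<close> obtains this from the recurrence of the Stirling numbers, according to
  what happens to the largest number $2n+2$ when \<open>n\<close> grows by one. If it is uncovered, so is $2n+1$,
  and what remains is a configuration on \<open>{1..2 * n}\<close> with one uncovered number less in each parity.
  If it is matched, its partner is one of the \<open>u\<close> uncovered odd numbers of the configuration that
  remains, or $2n+1$, which makes \<open>u + 1\<close> choices.
\<close>

section \<open>Perfect matchings of a finite set\<close>

lemma perfect_matching_on_iff:
  "perfect_matching_on A M \<longleftrightarrow> \<Union>M = A \<and> disjoint M \<and> (\<forall>m\<in>M. card m = 2)"
  by (auto simp: perfect_matching_on_def partition_on_def)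

lemma finite_perfect_matchings:
  assumes "finite A"
  shows "finite {M. perfect_matching_on A M}"
  by (rule finite_subset[of _ "Pow (Pow A)"]) (use assms in \<open>auto simp: perfect_matching_on_iff\<close>)

lemma card_Int_Union_disjoint:
  assumes "disjoint Q" "finite Q" "\<And>m. m \<in> Q \<Longrightarrow> finite m"
  shows "card (A \<inter> \<Union>Q) = (\<Sum>m\<in>Q. card (A \<inter> m))"
proof -
  have "A \<inter> \<Union>Q = (\<Union>m\<in>Q. A \<inter> m)" by auto
  also have "card \<dots> = (\<Sum>m\<in>Q. card (A \<inter> m))"
    by (rule card_UN_disjoint) (use assms in \<open>auto simp: disjoint_def\<close>)
  finally show ?thesis .
qed

lemma perfect_matching_on_insert:
  assumes x: "x \<in> A" and b: "b \<in> A" "b \<noteq> x"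
    and M: "perfect_matching_on (A - {x, b}) M"
  shows "perfect_matching_on A (insert {x, b} M)"
  using assms by (auto simp: perfect_matching_on_iff disjoint_def)

lemma perfect_matching_on_remove:
  assumes M: "perfect_matching_on A M" and m: "m \<in> M"
  shows "perfect_matching_on (A - m) (M - {m})"
  using assms unfolding perfect_matching_on_iff disjoint_def by blast

text \<open>A perfect matching amounts to the partner \<open>b\<close> of a fixed element \<open>x\<close> together with a perfect
  matching of everything else; this gives the recurrence of the double factorial.\<close>

lemma perfect_matchings_by_partner:
  assumes x: "x \<in> A"
  shows "bij_betw (\<lambda>(b, M). insert {x, b} M)
    (SIGMA b:A - {x}. {M. perfect_matching_on (A - {x, b}) M}) {M. perfect_matching_on A M}"
    (is "bij_betw ?f ?S ?T")
  unfolding bij_betw_def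
proof
  have notin: "x \<notin> \<Union>M" if "perfect_matching_on (A - {x, b}) M" for b M
    using that by (auto simp: perfect_matching_on_iff)
  show "inj_on ?f ?S"
  proof (rule inj_onI)
    fix p q assume "p \<in> ?S" "q \<in> ?S" "?f p = ?f q"
    then obtain b M c N where pq: "p = (b, M)" "q = (c, N)"
      and M: "perfect_matching_on (A - {x, b}) M" and N: "perfect_matching_on (A - {x, c}) N"
      and eq: "insert {x, b} M = insert {x, c} N" by auto
    have "{x, b} \<notin> N" "{x, b} \<notin> M" "{x, c} \<notin> N"
      using notin[OF N] notin[OF M] by auto
    moreover from this have "{x, b} = {x, c}" using eq by blast
    ultimately have "b = c" "M = N" using eq by (metis doubleton_eq_iff insert_ident)+
    then show "p = q" using pq by simp
  qed
  show "?f ` ?S = ?T"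
  proof (intro equalityI subsetI)
    fix M assume "M \<in> ?f ` ?S"
    then show "M \<in> ?T" using perfect_matching_on_insert[OF x] by auto
  next
    fix M assume "M \<in> ?T"
    then have M: "perfect_matching_on A M" by simp
    then obtain m where m: "m \<in> M" "x \<in> m" using x by (auto simp: perfect_matching_on_iff)
    have "card m = 2" using M m by (simp add: perfect_matching_on_iff)
    then obtain c d where "m = {c, d}" "c \<noteq> d" by (auto simp: card_2_iff)
    with m(2) obtain b where b: "m = {x, b}" "b \<noteq> x" by (cases "x = c") auto
    have "b \<in> A" using M m b by (auto simp: perfect_matching_on_iff)
    moreover have "perfect_matching_on (A - {x, b}) (M - {m})"
      using perfect_matching_on_remove[OF M m(1)] b by simp
    moreover have "M = insert {x, b} (M - {m})" using m b by auto
    ultimately show "M \<in> ?f ` ?S"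
      using b(2) by (intro image_eqI[of _ _ "(b, M - {m})"]) auto
  qed
qed

lemma card_perfect_matchings:
  assumes "card A = 2 * k" "finite A"
  shows "card {M. perfect_matching_on A M} = odd_double_fact k"
  using assms
proof (induction k arbitrary: A)
  case 0
  then have "{M. perfect_matching_on A M} = {{}}"
    by (fastforce simp: perfect_matching_on_iff)
  then show ?case by (simp add: odd_double_fact_def)
next
  case (Suc k)
  then obtain x where x: "x \<in> A" by fastforce
  have "card {M. perfect_matching_on A M}
      = card (SIGMA b:A - {x}. {M. perfect_matching_on (A - {x, b}) M})"
    using bij_betw_same_card[OF perfect_matchings_by_partner[OF x]] by simp
  also have "\<dots> = (\<Sum>b\<in>A - {x}. card {M. perfect_matching_on (A - {x, b}) M})"
    using Suc.prems by (intro card_SigmaI) (auto intro: finite_perfect_matchings)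
  also have "\<dots> = (\<Sum>b\<in>A - {x}. odd_double_fact k)"
  proof (rule sum.cong[OF refl])
    fix b assume b: "b \<in> A - {x}"
    have "card (A - {x, b}) = 2 * k"
      using b x Suc.prems by (subst card_Diff_subset) auto
    then show "card {M. perfect_matching_on (A - {x, b}) M} = odd_double_fact k"
      using Suc.IH Suc.prems by simp
  qed
  also have "\<dots> = (2 * k + 1) * odd_double_fact k"
    using x Suc.prems by simp
  also have "\<dots> = odd_double_fact (Suc k)"
    by (simp add: odd_double_fact_def)
  finally show ?case .
qed

section \<open>Matches classified by parity\<close>

definition odd_to_even :: "nat set \<Rightarrow> bool" where
  "odd_to_even m \<longleftrightarrow> (\<exists>a b. m = {a, b} \<and> odd a \<and> even b \<and> a < b)"

definition odd_to_odd :: "nat set \<Rightarrow> bool" where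
  "odd_to_odd m \<longleftrightarrow> (\<exists>a b. m = {a, b} \<and> odd a \<and> odd b \<and> a \<noteq> b)"

lemma parity_cases:
  assumes "card m = 2"
  obtains "even_to_odd m" | "odd_to_even m" | "even_to_even m" | "odd_to_odd m"
proof -
  obtain a b where m: "m = {a, b}" "a < b"
    using assms unfolding card_2_iff by (metis insert_commute nat_neq_iff)
  then show thesis using that
    unfolding even_to_odd_def odd_to_even_def even_to_even_def odd_to_odd_def
    by (metis nat_neq_iff)
qed

text \<open>The numbers of even and odd elements tell the three kinds apart that a matching without
  even-to-odd matches can contain. Summed over all matches, they also yield the size of the covered
  part of each parity.\<close>

lemma parity_counts:
  shows odd_to_even_counts:
      "odd_to_even m \<Longrightarrow> card m = 2 \<and> card (Collect even \<inter> m) = 1 \<and> card (Collect odd \<inter> m) = 1"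
    and even_to_even_counts:
      "even_to_even m \<Longrightarrow> card m = 2 \<and> card (Collect even \<inter> m) = 2 \<and> card (Collect odd \<inter> m) = 0"
    and odd_to_odd_counts:
      "odd_to_odd m \<Longrightarrow> card m = 2 \<and> card (Collect even \<inter> m) = 0 \<and> card (Collect odd \<inter> m) = 2"
    and even_to_odd_not: "even_to_odd m \<Longrightarrow> \<not> odd_to_even m \<and> \<not> even_to_even m \<and> \<not> odd_to_odd m"
  by (auto simp: odd_to_even_def even_to_even_def odd_to_odd_def even_to_odd_def doubleton_eq_iff)

lemma parity_exclusive:
  "odd_to_even m \<Longrightarrow> \<not> even_to_even m" "odd_to_even m \<Longrightarrow> \<not> odd_to_odd m"
  "even_to_even m \<Longrightarrow> \<not> odd_to_odd m"
  using parity_counts(1-3)[of m] by auto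

lemma even_to_even_iff: "even_to_even m \<longleftrightarrow> card m = 2 \<and> m \<subseteq> Collect even"
  unfolding even_to_even_def card_2_iff by blast

lemma odd_to_odd_iff: "odd_to_odd m \<longleftrightarrow> card m = 2 \<and> m \<subseteq> Collect odd"
  unfolding odd_to_odd_def card_2_iff by blast

section \<open>Partial matchings by odd-to-even matches\<close>

text \<open>The index \<open>u\<close> is the number of uncovered elements of either parity. Indexing by it instead of by
  the number of matches avoids truncated subtraction and aligns the recurrence in \<open>n\<close> with that of
  the Stirling numbers.\<close>

definition odd_to_even_matchings :: "nat \<Rightarrow> nat \<Rightarrow> nat set set set" where
  "odd_to_even_matchings n u =
     {P. disjoint P \<and> (\<forall>m\<in>P. odd_to_even m \<and> m \<subseteq> {1..2 * n}) \<and> card P + u = n}"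

lemma finite_odd_to_even_matchings: "finite (odd_to_even_matchings n u)"
  by (rule finite_subset[of _ "Pow (Pow {1..2 * n})"]) (auto simp: odd_to_even_matchings_def)

lemma finite_of_odd_to_even_matchings:
  assumes "P \<in> odd_to_even_matchings n u"
  shows "finite P" "m \<in> P \<Longrightarrow> finite m"
proof -
  have "P \<subseteq> Pow {1..2 * n}" using assms by (auto simp: odd_to_even_matchings_def)
  then show "finite P" "m \<in> P \<Longrightarrow> finite m"
    by (auto intro: finite_subset)
qed

lemma card_parity_interval:
  "card (Collect even \<inter> {1..2 * n}) = n" "card (Collect odd \<inter> {1..2 * n}) = n"
proof -
  have "Collect even \<inter> {1..2 * n} = (\<lambda>i. 2 * i) ` {1..n}"
    by (auto elim!: evenE)
  then show "card (Collect even \<inter> {1..2 * n}) = n"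
    by (simp add: card_image inj_on_def)
  have "Collect odd \<inter> {1..2 * n} = (\<lambda>i. 2 * i + 1) ` {..<n}"
    by (auto elim!: oddE)
  then show "card (Collect odd \<inter> {1..2 * n}) = n"
    by (simp add: card_image inj_on_def)
qed

lemma card_uncovered:
  assumes P: "P \<in> odd_to_even_matchings n u"
  shows "card (Collect even \<inter> {1..2 * n} - \<Union>P) = u"
    and "card (Collect odd \<inter> {1..2 * n} - \<Union>P) = u"
proof -
  have sub: "\<Union>P \<subseteq> {1..2 * n}" using P by (auto simp: odd_to_even_matchings_def)
  have *: "card (A \<inter> {1..2 * n} - \<Union>P) = u"
    if A: "card (A \<inter> {1..2 * n}) = n" "\<And>m. odd_to_even m \<Longrightarrow> card (A \<inter> m) = 1" for A
  proof -
    have "card (A \<inter> \<Union>P) = (\<Sum>m\<in>P. card (A \<inter> m))"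
      using P finite_of_odd_to_even_matchings[OF P]
      by (intro card_Int_Union_disjoint) (auto simp: odd_to_even_matchings_def)
    also have "\<dots> = card P"
      using P A(2) by (simp add: odd_to_even_matchings_def)
    finally have "card (A \<inter> \<Union>P) = card P" .
    moreover have "A \<inter> {1..2 * n} - \<Union>P = A \<inter> {1..2 * n} - A \<inter> \<Union>P" by auto
    moreover have "card (A \<inter> {1..2 * n} - A \<inter> \<Union>P) = card (A \<inter> {1..2 * n}) - card (A \<inter> \<Union>P)"
      using sub by (intro card_Diff_subset) (auto intro: finite_subset)
    moreover have "card P + u = n" using P by (simp add: odd_to_even_matchings_def)
    ultimately show ?thesis using A(1) by simp
  qed
  show "card (Collect even \<inter> {1..2 * n} - \<Union>P) = u" "card (Collect odd \<inter> {1..2 * n} - \<Union>P) = u"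
    using *[OF card_parity_interval(1)] *[OF card_parity_interval(2)] odd_to_even_counts by simp_all
qed

text \<open>The only larger even number available to $2n+1$ is $2n+2$. Hence a match that avoids $2n+2$
  avoids $2n+1$ as well.\<close>

lemma odd_to_even_within_Suc:
  assumes "odd_to_even m" "m \<subseteq> {1..2 * Suc n}" "2 * Suc n \<notin> m"
  shows "m \<subseteq> {1..2 * n}"
proof -
  obtain a b where m: "m = {a, b}" "odd a" "even b" "a < b"
    using assms(1) by (auto simp: odd_to_even_def)
  have "b \<noteq> 2 * Suc n" "b \<noteq> 2 * n + 1" using assms(3) m by auto
  then have "b \<le> 2 * n" using assms(2) m by auto
  then show ?thesis using m assms(2) by auto
qed

text \<open>If $2n+2$ is uncovered, the set of matches is unchanged on passing to \<open>{1..2 * n}\<close>, so that \<open>u\<close>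
  drops by one together with \<open>n\<close>.\<close>

lemma odd_to_even_matchings_Suc_unmatched:
  "{P \<in> odd_to_even_matchings (Suc n) u. 2 * Suc n \<notin> \<Union>P}
    = (case u of 0 \<Rightarrow> {} | Suc v \<Rightarrow> odd_to_even_matchings n v)"
proof -
  have *: "2 * Suc n \<notin> \<Union>P \<and> (\<forall>m\<in>P. odd_to_even m \<and> m \<subseteq> {1..2 * Suc n})
      \<longleftrightarrow> (\<forall>m\<in>P. odd_to_even m \<and> m \<subseteq> {1..2 * n})" for P
    using odd_to_even_within_Suc[of _ n] by fastforce
  have **: "{P \<in> odd_to_even_matchings (Suc n) u. 2 * Suc n \<notin> \<Union>P}
      = {P. disjoint P \<and> (\<forall>m\<in>P. odd_to_even m \<and> m \<subseteq> {1..2 * n}) \<and> card P + u = Suc n}"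
    unfolding odd_to_even_matchings_def mem_Collect_eq by (rule Collect_cong) (use * in metis)
  show ?thesis
  proof (cases u)
    case 0
    \<comment> \<open>The \<open>n + 1\<close> matches would need \<open>n + 1\<close> distinct odd numbers from \<open>{1..2 * n}\<close>.\<close>
    have False if "disjoint P" "\<forall>m\<in>P. odd_to_even m \<and> m \<subseteq> {1..2 * n}" "card P = Suc n" for P
    proof -
      have "P \<subseteq> Pow {1..2 * n}" using that by auto
      then have fin: "finite P" "\<And>m. m \<in> P \<Longrightarrow> finite m" by (auto intro: finite_subset)
      have "card P = (\<Sum>m\<in>P. card (Collect odd \<inter> m))"
        using that(2) odd_to_even_counts by simp
      also have "\<dots> = card (Collect odd \<inter> \<Union>P)"
        by (rule card_Int_Union_disjoint[symmetric]) (use that fin in auto)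
      also have "\<dots> \<le> card (Collect odd \<inter> {1..2 * n})"
        using that(2) by (intro card_mono) auto
      also have "\<dots> = n" by (rule card_parity_interval)
      finally show False using that(3) by simp
    qed
    then show ?thesis unfolding ** using 0 by auto
  next
    case (Suc v)
    then show ?thesis unfolding ** by (simp add: odd_to_even_matchings_def)
  qed
qed

text \<open>Removing the match of $2n+2$ lowers both \<open>n\<close> and the number of matches by one, hence keeps \<open>u\<close>.
  It can be put back with any uncovered odd number as partner, because all odd numbers in
  \<open>{1..2 * Suc n}\<close> are smaller than $2n+2$.\<close>

lemma odd_to_even_matchings_Suc_matched:
  "bij_betw (\<lambda>(Q, a). insert {a, 2 * Suc n} Q)
    (SIGMA Q:odd_to_even_matchings n u. Collect odd \<inter> {1..2 * Suc n} - \<Union>Q)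
    {P \<in> odd_to_even_matchings (Suc n) u. 2 * Suc n \<in> \<Union>P}"
    (is "bij_betw ?f ?S ?T")
  unfolding bij_betw_def
proof
  have notin: "2 * Suc n \<notin> \<Union>Q" if "Q \<in> odd_to_even_matchings n u" for Q
    using that by (fastforce simp: odd_to_even_matchings_def)
  show "inj_on ?f ?S"
  proof (rule inj_onI)
    fix p q assume "p \<in> ?S" "q \<in> ?S" "?f p = ?f q"
    then obtain Q a R c where pq: "p = (Q, a)" "q = (R, c)"
      and Q: "Q \<in> odd_to_even_matchings n u" and R: "R \<in> odd_to_even_matchings n u"
      and eq: "insert {a, 2 * Suc n} Q = insert {c, 2 * Suc n} R"
      by (auto simp del: mult_Suc_right)
    have "{a, 2 * Suc n} \<notin> R" "{a, 2 * Suc n} \<notin> Q" "{c, 2 * Suc n} \<notin> R"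
      using notin[OF Q] notin[OF R] by auto
    moreover from this have "{a, 2 * Suc n} = {c, 2 * Suc n}" using eq by blast
    ultimately have "Q = R" "a = c" using eq by (metis doubleton_eq_iff insert_ident)+
    then show "p = q" using pq by simp
  qed
  show "?f ` ?S = ?T"
  proof (intro equalityI subsetI)
    fix P assume "P \<in> ?f ` ?S"
    then obtain Q a where Q: "Q \<in> odd_to_even_matchings n u" "odd a" "a \<in> {1..2 * Suc n}"
      "a \<notin> \<Union>Q" "P = insert {a, 2 * Suc n} Q" by auto
    have "disjoint Q" using Q by (simp add: odd_to_even_matchings_def)
    then have "disjoint P" using Q notin[OF Q(1)] by (auto simp: disjoint_def)
    moreover have "card P = Suc (card Q)"
      using Q notin[OF Q(1)] finite_of_odd_to_even_matchings(1)[OF Q(1)]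
      by (subst Q(5), subst card_insert_disjoint) auto
    moreover have "even (2 * Suc n)" by simp
    then have "a < 2 * Suc n" using Q(2,3) by (metis atLeastAtMost_iff le_neq_implies_less)
    then have "odd_to_even {a, 2 * Suc n}"
      unfolding odd_to_even_def using Q(2) \<open>even (2 * Suc n)\<close> by metis
    ultimately show "P \<in> ?T" using Q by (fastforce simp: odd_to_even_matchings_def)
  next
    fix P assume "P \<in> ?T"
    then have P: "P \<in> odd_to_even_matchings (Suc n) u" and "2 * Suc n \<in> \<Union>P" by auto
    then obtain m where m: "m \<in> P" "2 * Suc n \<in> m" by auto
    have oe: "odd_to_even m" "m \<subseteq> {1..2 * Suc n}"
      using P m by (auto simp: odd_to_even_matchings_def)
    then obtain a b where ab: "m = {a, b}" "odd a" "even b" by (auto simp: odd_to_even_def)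
    have "a \<noteq> 2 * Suc n" using ab(2) by auto
    then have a: "m = {a, 2 * Suc n}" "odd a" using ab m(2) by auto
    have dj: "c \<inter> d = {}" if "c \<in> P" "d \<in> P" "c \<noteq> d" for c d
      using P that by (auto simp: odd_to_even_matchings_def disjoint_def)
    let ?Q = "P - {m}"
    have "m' \<subseteq> {1..2 * n}" if "m' \<in> ?Q" for m'
    proof (rule odd_to_even_within_Suc)
      show "odd_to_even m'" "m' \<subseteq> {1..2 * Suc n}"
        using P that by (simp_all add: odd_to_even_matchings_def)
      show "2 * Suc n \<notin> m'" using dj[of m m'] m that by blast
    qed
    moreover have "Suc (card ?Q) = card P"
      using card.remove[OF finite_of_odd_to_even_matchings(1)[OF P] m(1)] by simp
    moreover have "disjoint ?Q" using dj by (simp add: disjoint_def)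
    ultimately have "?Q \<in> odd_to_even_matchings n u"
      using P by (simp add: odd_to_even_matchings_def)
    moreover have "a \<notin> \<Union>?Q" using dj[OF m(1)] a(1) by blast
    moreover have "a \<in> {1..2 * Suc n}" using oe(2) a(1) by blast
    ultimately have "(?Q, a) \<in> ?S" using a(2) by blast
    moreover have "P = ?f (?Q, a)" using m(1) a(1) by auto
    ultimately show "P \<in> ?f ` ?S" by (rule rev_image_eqI)
  qed
qed

lemma card_uncovered_odd_Suc:
  assumes "Q \<in> odd_to_even_matchings n u"
  shows "card (Collect odd \<inter> {1..2 * Suc n} - \<Union>Q) = Suc u"
proof -
  have "2 * n + 1 \<notin> \<Union>Q" using assms by (fastforce simp: odd_to_even_matchings_def)
  then have "Collect odd \<inter> {1..2 * Suc n} - \<Union>Q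
      = insert (2 * n + 1) (Collect odd \<inter> {1..2 * n} - \<Union>Q)"
    by (auto simp: le_Suc_eq)
  then show ?thesis using card_uncovered(2)[OF assms] by simp
qed

text \<open>The two cases for $2n+2$ are the two summands of
  $S(n+2,u+1) = (u+1)\,S(n+1,u+1) + S(n+1,u)$.\<close>

lemma card_odd_to_even_matchings:
  "card (odd_to_even_matchings n u) = Stirling (Suc n) (Suc u)"
proof (induction n arbitrary: u)
  case 0
  have "odd_to_even_matchings 0 u = (if u = 0 then {{}} else {})"
    by (auto simp: odd_to_even_matchings_def odd_to_even_def)
  then show ?case by (cases u) auto
next
  case (Suc n)
  let ?X = "{P \<in> odd_to_even_matchings (Suc n) u. 2 * Suc n \<notin> \<Union>P}"
  let ?Y = "{P \<in> odd_to_even_matchings (Suc n) u. 2 * Suc n \<in> \<Union>P}"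
  have "card (odd_to_even_matchings (Suc n) u) = card (?X \<union> ?Y)"
    by (rule arg_cong[where f = card]) blast
  also have "\<dots> = card ?X + card ?Y"
    by (rule card_Un_disjoint)
      (auto intro: finite_subset[OF _ finite_odd_to_even_matchings[of "Suc n" u]])
  also have "card ?X = Stirling (Suc n) u"
    unfolding odd_to_even_matchings_Suc_unmatched using Suc.IH by (cases u) auto
  also have "card ?Y
      = card (SIGMA Q:odd_to_even_matchings n u. Collect odd \<inter> {1..2 * Suc n} - \<Union>Q)"
    using bij_betw_same_card[OF odd_to_even_matchings_Suc_matched[of n u]] by simp
  also have "\<dots> = (\<Sum>Q\<in>odd_to_even_matchings n u. card (Collect odd \<inter> {1..2 * Suc n} - \<Union>Q))"
    by (intro card_SigmaI) (auto intro: finite_odd_to_even_matchings)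
  also have "\<dots> = Suc u * Stirling (Suc n) (Suc u)"
    using card_uncovered_odd_Suc Suc.IH by simp
  finally show ?case by simp
qed

section \<open>Decomposition by parity\<close>

text \<open>Matching the numbers left over by \<open>P\<close> within their own parity creates no further odd-to-even
  match, so the three pieces can be read off from their union by parity. The value \<open>k\<close> enters by
  counting even numbers: \<open>n\<close> equals the number of odd-to-even matches plus twice the number of
  even-to-even matches.\<close>

lemma perfect_matching_parity_decomposition:
  "bij_betw (\<lambda>(P, E, U). P \<union> E \<union> U)
    (SIGMA P:odd_to_even_matchings n (2 * k).
       {E. perfect_matching_on (Collect even \<inter> {1..2 * n} - \<Union>P) E} \<times>
       {U. perfect_matching_on (Collect odd \<inter> {1..2 * n} - \<Union>P) U})
    {M. perfect_matching_on {1..2 * n} M \<and> \<not> (\<exists>m\<in>M. even_to_odd m)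
      \<and> card {m \<in> M. even_to_even m} = k}"
    (is "bij_betw ?f ?S ?T")
proof -
  define g where
    "g M = ({m \<in> M. odd_to_even m}, {m \<in> M. even_to_even m}, {m \<in> M. odd_to_odd m})" for M
  have S: "g (?f x) = x \<and> ?f x \<in> ?T" if "x \<in> ?S" for x
  proof -
    obtain P E U where x: "x = (P, E, U)" and P: "P \<in> odd_to_even_matchings n (2 * k)"
      and E: "perfect_matching_on (Collect even \<inter> {1..2 * n} - \<Union>P) E"
      and U: "perfect_matching_on (Collect odd \<inter> {1..2 * n} - \<Union>P) U"
      using \<open>x \<in> ?S\<close> by auto
    have un: "\<Union>P \<subseteq> {1..2 * n}" "\<Union>E = Collect even \<inter> {1..2 * n} - \<Union>P"
        "\<Union>U = Collect odd \<inter> {1..2 * n} - \<Union>P"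
      and dj: "disjoint P" "disjoint E" "disjoint U"
      using P E U unfolding odd_to_even_matchings_def perfect_matching_on_iff by auto
    have kinds: "\<forall>m\<in>P. odd_to_even m" "\<forall>m\<in>E. even_to_even m" "\<forall>m\<in>U. odd_to_odd m"
    proof -
      show "\<forall>m\<in>P. odd_to_even m" using P by (simp add: odd_to_even_matchings_def)
      have "\<Union>E \<subseteq> Collect even" "\<Union>U \<subseteq> Collect odd" using un(2,3) by auto
      then show "\<forall>m\<in>E. even_to_even m" "\<forall>m\<in>U. odd_to_odd m"
        using E U by (auto simp: perfect_matching_on_iff even_to_even_iff odd_to_odd_iff)
    qed
    have g: "g (P \<union> E \<union> U) = (P, E, U)"
      unfolding g_def using kinds parity_exclusive by blast
    have "\<Union>(P \<union> E \<union> U) = {1..2 * n}" using un by auto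
    moreover have "disjoint (P \<union> E \<union> U)"
      by (intro disjoint_union dj) (use un in auto)
    moreover have "\<forall>m\<in>P \<union> E \<union> U. card m = 2" using kinds parity_counts(1-3) by blast
    ultimately have pm: "perfect_matching_on {1..2 * n} (P \<union> E \<union> U)"
      by (simp add: perfect_matching_on_iff)
    have noeo: "\<not> (\<exists>m\<in>P \<union> E \<union> U. even_to_odd m)" using kinds even_to_odd_not by blast
    have finE: "finite E" "\<And>m. m \<in> E \<Longrightarrow> finite m"
    proof -
      have "finite (\<Union>E)" using un(2) by simp
      then show "finite E" "\<And>m. m \<in> E \<Longrightarrow> finite m"
        by (auto intro: finite_UnionD finite_subset[OF Union_upper])
    qed
    have "2 * k = card (Collect even \<inter> \<Union>E)"
      using card_uncovered(1)[OF P] un(2) by (simp add: Int_Diff[symmetric] Int_assoc[symmetric])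
    also have "\<dots> = (\<Sum>m\<in>E. card (Collect even \<inter> m))"
      using dj(2) finE by (rule card_Int_Union_disjoint)
    also have "\<dots> = 2 * card E" using kinds(2) even_to_even_counts by simp
    finally have "card E = k" by simp
    then have "card {m \<in> P \<union> E \<union> U. even_to_even m} = k" using g by (simp add: g_def)
    then show ?thesis using g pm noeo x by simp
  qed
  have T: "g M \<in> ?S \<and> ?f (g M) = M" if "M \<in> ?T" for M
  proof -
    have M: "\<Union>M = {1..2 * n}" "disjoint M" "\<And>m. m \<in> M \<Longrightarrow> card m = 2"
      and noeo: "\<And>m. m \<in> M \<Longrightarrow> \<not> even_to_odd m" and k: "card {m \<in> M. even_to_even m} = k"
      using that by (auto simp: perfect_matching_on_iff)
    define P E U where "P = {m \<in> M. odd_to_even m}" and "E = {m \<in> M. even_to_even m}"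
      and "U = {m \<in> M. odd_to_odd m}"
    have eq: "P \<union> E \<union> U = M"
      using noeo M(3) parity_cases unfolding P_def E_def U_def by blast
    have fin: "finite M" "\<And>m. m \<in> M \<Longrightarrow> finite m"
    proof -
      have "finite (\<Union>M)" using M(1) by simp
      then show "finite M" "\<And>m. m \<in> M \<Longrightarrow> finite m"
        by (auto intro: finite_UnionD finite_subset[OF Union_upper])
    qed
    have dj: "disjoint P" "disjoint E" "disjoint U"
      using M(2) by (auto simp: disjoint_def P_def E_def U_def)
    have PE: "P \<inter> E = {}" "(P \<union> E) \<inter> U = {}"
      using parity_exclusive by (auto simp: P_def E_def U_def)
    have finPEU: "finite P" "finite E" "finite U" using fin(1) eq by auto
    have "n = card (Collect even \<inter> \<Union>M)" using M(1) card_parity_interval(1) by simp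
    also have "\<dots> = (\<Sum>m\<in>M. card (Collect even \<inter> m))"
      using M(2) fin by (rule card_Int_Union_disjoint)
    also have "\<dots> = (\<Sum>m\<in>P. card (Collect even \<inter> m)) + (\<Sum>m\<in>E. card (Collect even \<inter> m))
        + (\<Sum>m\<in>U. card (Collect even \<inter> m))"
      unfolding eq[symmetric] using finPEU PE by (simp add: sum.union_disjoint)
    also have "\<dots> = card P + 2 * card E"
      using parity_counts(1-3) by (simp add: P_def E_def U_def)
    finally have "card P + 2 * k = n" using k by (simp add: E_def)
    then have P: "P \<in> odd_to_even_matchings n (2 * k)"
      using dj(1) M(1) by (auto simp: odd_to_even_matchings_def P_def)
    have cross: "c \<inter> d = {}" if "c \<in> M" "d \<in> M" "c \<noteq> d" for c d
      using M(2) that by (auto simp: disjoint_def)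
    have split: "e = V \<inter> I - p \<and> u = - V \<inter> I - p"
      if "e \<inter> p = {}" "u \<inter> p = {}" "e \<subseteq> V" "u \<subseteq> - V" "I = p \<union> e \<union> u"
      for e u p V I :: "nat set"
      using that by auto
    have "\<Union>E \<inter> \<Union>P = {}" "\<Union>U \<inter> \<Union>P = {}"
      using cross PE eq by blast+
    moreover have "\<Union>E \<subseteq> Collect even" "\<Union>U \<subseteq> - Collect even"
      by (auto simp: E_def U_def even_to_even_iff odd_to_odd_iff)
    moreover have "{1..2 * n} = \<Union>P \<union> \<Union>E \<union> \<Union>U" using M(1) eq by blast
    ultimately have "\<Union>E = Collect even \<inter> {1..2 * n} - \<Union>P
        \<and> \<Union>U = - Collect even \<inter> {1..2 * n} - \<Union>P"
      by (rule split)
    moreover have "- Collect even = Collect (odd :: nat \<Rightarrow> bool)" by auto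
    ultimately have "\<Union>E = Collect even \<inter> {1..2 * n} - \<Union>P"
      "\<Union>U = Collect odd \<inter> {1..2 * n} - \<Union>P"
      by simp_all
    moreover have "\<forall>m\<in>E. card m = 2" "\<forall>m\<in>U. card m = 2"
      using M(3) by (auto simp: E_def U_def)
    ultimately have "(P, E, U) \<in> ?S" using P dj by (simp add: perfect_matching_on_iff)
    moreover have "g M = (P, E, U)" by (simp add: g_def P_def E_def U_def)
    ultimately show ?thesis using eq by simp
  qed
  show ?thesis
  proof (rule bij_betw_byWitness[where f' = g])
    show "\<forall>x\<in>?S. g (?f x) = x" using S[THEN conjunct1] by (rule ballI)
    show "\<forall>M\<in>?T. ?f (g M) = M" using T[THEN conjunct2] by (rule ballI)
    show "?f ` ?S \<subseteq> ?T" using S[THEN conjunct2] by (rule image_subsetI)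
    show "g ` ?T \<subseteq> ?S" using T[THEN conjunct1] by (rule image_subsetI)
  qed
qed

theorem proposition6:
  fixes n k :: nat
  assumes "n \<ge> 1"
  shows "card {M. perfect_matching_on {1..2 * n} M
             \<and> \<not> (\<exists>m\<in>M. even_to_odd m)
             \<and> card {m \<in> M. even_to_even m} = k}
         = (odd_double_fact k)\<^sup>2 * Stirling (n + 1) (2 * k + 1)"
proof -
  let ?pm = "\<lambda>A. {M. perfect_matching_on A M}"
  let ?even = "\<lambda>P. Collect even \<inter> {1..2 * n} - \<Union>P"
  let ?odd = "\<lambda>P. Collect odd \<inter> {1..2 * n} - \<Union>P"
  have "card {M. perfect_matching_on {1..2 * n} M \<and> \<not> (\<exists>m\<in>M. even_to_odd m)
      \<and> card {m \<in> M. even_to_even m} = k}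
      = card (SIGMA P:odd_to_even_matchings n (2 * k). ?pm (?even P) \<times> ?pm (?odd P))"
    using bij_betw_same_card[OF perfect_matching_parity_decomposition[of n k]] by simp
  also have "\<dots> = (\<Sum>P\<in>odd_to_even_matchings n (2 * k). card (?pm (?even P) \<times> ?pm (?odd P)))"
    by (intro card_SigmaI)
      (auto intro!: finite_odd_to_even_matchings finite_cartesian_product finite_perfect_matchings)
  also have "\<dots> = (\<Sum>P\<in>odd_to_even_matchings n (2 * k). (odd_double_fact k)\<^sup>2)"
  proof (rule sum.cong[OF refl])
    fix P assume "P \<in> odd_to_even_matchings n (2 * k)"
    then have "card (?pm (?even P)) = odd_double_fact k" "card (?pm (?odd P)) = odd_double_fact k"
      using card_uncovered by (simp_all add: card_perfect_matchings)
    then show "card (?pm (?even P) \<times> ?pm (?odd P)) = (odd_double_fact k)\<^sup>2"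
      by (simp add: card_cartesian_product power2_eq_square)
  qed
  also have "\<dots> = (odd_double_fact k)\<^sup>2 * Stirling (n + 1) (2 * k + 1)"
    using card_odd_to_even_matchings[of n "2 * k"] by simp
  finally show ?thesis .
qed

end
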